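(* Let $H=[P,Q;-Q^\top,R^\top]$ be a skew Hadamard matrix of size $2n$ in which $P,Q,R$ are negacirculant $n\times n$ matrices. Then $Q$ is nonsingular and $R=P$.
   Context: Skew Hadamard: $H\in\{\pm1\}^{m\times m}$ with $HH^\top=mI_m$ and $H+H^\top=2I_m$. An $n\times n$ matrix is negacirculant if there is $w=(w_0,\dots,w_{n-1})$ with $(i,j)$ entry $w_{j-i}$ for $j\ge i$ and $-w_{n+j-i}$ for $j<i$ (indices $0,\dots,n-1$). *)

theory Defs
  imports Complex_Main "Jordan_Normal_Form.Matrix"
begin

(* The entries are taken in the reals rather than the integers because
   invertible_mat over the integers would mean unimodular, not nonsingular. *)

definition skew_hadamard :: "nat \<Rightarrow> real mat \<Rightarrow> bool" where
  "skew_hadamard m H \<longleftrightarrow>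
     H \<in> carrier_mat m m \<and>
     (\<forall>i<m. \<forall>j<m. H $$ (i, j) \<in> {1, -1}) \<and>
     H * transpose_mat H = real m \<cdot>\<^sub>m 1\<^sub>m m \<and>
     H + transpose_mat H = 2 \<cdot>\<^sub>m 1\<^sub>m m"

definition negacirculant :: "nat \<Rightarrow> real mat \<Rightarrow> bool" where
  "negacirculant n A \<longleftrightarrow>
     (\<exists>w \<in> carrier_vec n.
        A = mat n n (\<lambda>(i, j). if i \<le> j then w $ (j - i) else - (w $ (n + j - i))))"

end

theory Submission
  imports Defs "Jordan_Normal_Form.Determinant" "HOL-Number_Theory.Residues"
begin

text \<open>
  Orthogonality of \<open>H\<close> gives \<open>Q R = P Q\<close>, and negacirculants commute, so \<open>R = P\<close> as soon as \<open>Q\<close> is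
  nonsingular. If \<open>Q\<close> is singular, take an integer vector \<open>v \<noteq> 0\<close> with \<open>Q\<^sup>T v = 0\<close>. From
  \<open>P P\<^sup>T v = 2 n v\<close> and \<open>P\<^sup>T = 2 - P\<close> one gets \<open>(P - 1)\<^sup>2 v = - (2 n - 1) v\<close>. Extended antiperiodically,
  \<open>v\<close> becomes a sequence on which \<open>\<int>[X]\<close> acts by shifts with \<open>X\<close> of order dividing \<open>2 n\<close>, and \<open>P\<close> acts as a
  polynomial. As \<open>2 n - 1\<close> is coprime to \<open>2 n\<close>, it is unramified there: by the Frobenius map, every
  prime dividing it can be divided out of \<open>P - 1\<close>, so \<open>2 n - 1\<close> is a perfect square. But \<open>4\<close> divides
  \<open>2 n\<close> when \<open>n \<ge> 2\<close>, hence \<open>2 n - 1\<close> is \<open>3\<close> modulo \<open>4\<close>.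
\<close>

hide_const (open) up_ring.monom up_ring.coeff

section \<open>The Frobenius map on integer polynomials modulo a prime\<close>

lemma prime_dvd_freshman:
  fixes a b :: "'a::comm_ring_1"
  assumes "prime p"
  shows "of_nat p dvd (a + b) ^ p - (a ^ p + b ^ p)"
proof -
  have p: "p > 0" using assms prime_gt_0_nat by blast
  have "{..p} = insert 0 (insert p {0<..<p})" using p by auto
  then have "(a + b) ^ p = a ^ p + b ^ p + (\<Sum>k\<in>{0<..<p}. of_nat (p choose k) * a ^ k * b ^ (p - k))"
    using p by (simp add: binomial_ring algebra_simps)
  moreover have "of_nat p dvd (\<Sum>k\<in>{0<..<p}. of_nat (p choose k) * a ^ k * b ^ (p - k))"
  proof (rule dvd_sum)
    fix k assume "k \<in> {0<..<p}"
    then have "p dvd p choose k" by (intro dvd_choose_prime) (use assms in auto)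
    then show "of_nat p dvd of_nat (p choose k) * a ^ k * b ^ (p - k)"
      by (auto elim!: dvdE simp: mult.assoc)
  qed
  ultimately show ?thesis by simp
qed

text \<open>Divisibility at \<open>x\<close> and at \<open>x + 1\<close> are equivalent, which
  carries it from 0 to all integers, negative ones included.\<close>

lemma int_fermat:
  fixes a :: int
  assumes "prime p"
  shows "int p dvd a ^ p - a"
proof -
  have step: "int p dvd (x + 1) ^ p - (x + 1) \<longleftrightarrow> int p dvd x ^ p - x" for x :: int
  proof -
    have "(x + 1) ^ p - (x + 1) = ((x + 1) ^ p - (x ^ p + 1 ^ p)) + (x ^ p - x)" by simp
    with prime_dvd_freshman[OF assms, of x 1] show ?thesis
      by (metis dvd_add_right_iff of_nat_id)
  qed
  show ?thesis
  proof (induction a rule: int_induct[where k = 0])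
    case base
    then show ?case using assms prime_gt_0_nat[OF assms] by (simp add: power_0_left)
  next
    case (step1 i)
    then show ?case using step by blast
  next
    case (step2 i)
    then show ?case using step[of "i - 1"] by simp
  qed
qed

lemma pcompose_monom_one: "pcompose (monom 1 k) g = g ^ k"
  for g :: "'a::comm_ring_1 poly"
  by (induction k) (simp_all add: monom_Suc monom_0 pcompose_pCons one_pCons)

text \<open>Raising to the power \<open>p\<close> is additive modulo \<open>p\<close> and, by
  Fermat, fixes the constants, so only \<open>X\<close> moves.\<close>

lemma frobenius_pcompose:
  fixes f :: "int poly"
  assumes p: "prime p"
  shows "of_nat p dvd f ^ p - pcompose f (monom 1 p)"
proof (induction f)
  case 0
  then show ?case using prime_gt_0_nat[OF p] by (simp add: power_0_left)
next
  case (pCons a f)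
  let ?X = "monom 1 1 :: int poly"
  have split: "pCons a f = [:a:] + ?X * f"
    by (simp add: monom_Suc monom_0)
  have comp: "pcompose (pCons a f) (monom 1 p) = [:a:] + ?X ^ p * pcompose f (monom 1 p)"
    by (simp add: pcompose_pCons monom_power)
  obtain k where k: "a ^ p - a = int p * k" using int_fermat[OF p] by (metis dvdE)
  have "[:a:] ^ p - [:a:] = of_nat p * [:k:]"
    by (simp add: of_nat_poly poly_const_pow k)
  then have 1: "of_nat p dvd [:a:] ^ p - [:a:]" by (metis dvd_triv_left)
  have 2: "of_nat p dvd ?X ^ p * (f ^ p - pcompose f (monom 1 p))"
    using pCons.IH by (rule dvd_mult)
  have "(pCons a f) ^ p - pcompose (pCons a f) (monom 1 p)
     = (([:a:] + ?X * f) ^ p - ([:a:] ^ p + (?X * f) ^ p)) + ([:a:] ^ p - [:a:])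
       + ?X ^ p * (f ^ p - pcompose f (monom 1 p))"
    unfolding comp unfolding split by (simp add: power_mult_distrib algebra_simps)
  then show ?case
    using prime_dvd_freshman[OF p, of "[:a:]" "?X * f"] 1 2 by (simp only: dvd_add)
qed

lemma frobenius_pcompose_power:
  fixes f :: "int poly"
  assumes p: "prime p"
  shows "of_nat p dvd f ^ (p ^ k) - pcompose f (monom 1 (p ^ k))"
proof (induction k)
  case 0
  then show ?case by (simp add: monom_Suc monom_0 pcompose_idR)
next
  case (Suc k)
  let ?g = "pcompose f (monom 1 (p ^ k))"
  have "of_nat p dvd (f ^ (p ^ k)) ^ p - ?g ^ p"
    by (rule dvd_trans[OF Suc]) (simp add: power_diff_sumr2)
  then have "of_nat p dvd f ^ (p ^ Suc k) - ?g ^ p"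
    by (simp only: power_mult[symmetric] power_Suc2)
  moreover have "of_nat p dvd ?g ^ p - pcompose f (monom 1 (p ^ Suc k))"
  proof -
    have "pcompose (monom 1 (p ^ k)) (monom 1 p) = (monom 1 (p ^ Suc k) :: int poly)"
      by (simp add: pcompose_monom_one monom_power)
    then have "pcompose ?g (monom 1 p) = pcompose f (monom 1 (p ^ Suc k))"
      by (simp only: pcompose_assoc[symmetric])
    then show ?thesis using frobenius_pcompose[OF p, of ?g] by simp
  qed
  ultimately have "of_nat p dvd (f ^ (p ^ Suc k) - ?g ^ p) + (?g ^ p - pcompose f (monom 1 (p ^ Suc k)))"
    by (rule dvd_add)
  then show ?case by simp
qed

lemma pcompose_diff_dvd:
  fixes f :: "'a::comm_ring_1 poly"
  shows "g - h dvd pcompose f g - pcompose f h"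
proof (induction f)
  case (pCons a f)
  have "pcompose (pCons a f) g - pcompose (pCons a f) h
    = g * (pcompose f g - pcompose f h) + (g - h) * pcompose f h"
    by (simp add: pcompose_pCons algebra_simps)
  then show ?case using pCons.IH by simp
qed simp

text \<open>By Euler's theorem \<open>q = p ^ totient m\<close> is 1 modulo \<open>m\<close>, so
  \<open>X ^ q\<close> agrees with \<open>X\<close> modulo \<open>X ^ m - 1\<close>, and the
  iterated Frobenius map fixes every \<open>f\<close> modulo \<open>p\<close> and
  \<open>X ^ m - 1\<close>. The bound \<open>q \<ge> 2\<close> lets a square be split off from
  \<open>f ^ q\<close> in the descent.\<close>

lemma power_cong_mod_cyclic:
  fixes f :: "int poly"
  assumes p: "prime p" and "coprime p m" and "m > 0"
  obtains q g h where "q \<ge> 2" "f ^ q = f + of_nat p * g + (monom 1 m - 1) * h"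
proof -
  define k where "k = totient m"
  define q where "q = p ^ k"
  have "k > 0" using assms by (simp add: k_def)
  have q2: "q \<ge> 2"
    unfolding q_def using prime_ge_2_nat[OF p] \<open>k > 0\<close> by (metis le_trans self_le_power one_le_numeral)
  have "[q = 1] (mod m)" unfolding q_def k_def using assms by (intro euler_theorem) auto
  then have "m dvd q - 1" using q2 by (simp add: cong_altdef_nat)
  then obtain c where "q - 1 = m * c" by (elim dvdE)
  then have c: "q = Suc (m * c)" using q2 by simp
  have "monom 1 m - 1 dvd (monom 1 q - monom 1 1 :: int poly)"
  proof -
    have "monom 1 q - monom 1 1 = monom 1 1 * ((monom 1 m) ^ c - 1 :: int poly)"
      by (simp add: c algebra_simps monom_power mult_monom)
    moreover have "monom 1 m - 1 dvd ((monom 1 m) ^ c - 1 :: int poly)"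
      by (metis dvd_triv_left power_diff_1_eq)
    ultimately show ?thesis by simp
  qed
  then have "monom 1 m - 1 dvd pcompose f (monom 1 q) - pcompose f (monom 1 1)"
    using pcompose_diff_dvd dvd_trans by blast
  then obtain h where h: "pcompose f (monom 1 q) - f = (monom 1 m - 1) * h"
    by (auto simp: monom_Suc monom_0 pcompose_idR elim!: dvdE)
  obtain g where g: "f ^ q - pcompose f (monom 1 q) = of_nat p * g"
    using frobenius_pcompose_power[OF p, of f k] unfolding q_def by (auto elim!: dvdE)
  have "f ^ q = f + of_nat p * g + (monom 1 m - 1) * h"
    using g h by (simp add: algebra_simps)
  with q2 that show ?thesis by blast
qed

section \<open>Polynomials acting on sequences by shifts\<close>

text \<open>\<open>X\<close> acts by moving a sequence one place to the left. A relation such as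
  \<open>X ^ n = - 1\<close> becomes a property of the sequence acted on, so plain polynomials take
  the place of a quotient ring.\<close>

definition shift_act :: "'a::comm_ring_1 poly \<Rightarrow> (nat \<Rightarrow> 'a) \<Rightarrow> nat \<Rightarrow> 'a" where
  "shift_act f v i = (\<Sum>k\<le>degree f. coeff f k * v (i + k))"

lemma shift_act_eq:
  assumes "degree f \<le> d"
  shows "shift_act f v i = (\<Sum>k\<le>d. coeff f k * v (i + k))"
  unfolding shift_act_def using assms
  by (intro sum.mono_neutral_left) (auto simp: coeff_eq_0)

lemma shift_act_0 [simp]: "shift_act 0 v i = 0"
  by (simp add: shift_act_def)

lemma shift_act_pCons [simp]: "shift_act (pCons a f) v i = a * v i + shift_act f v (Suc i)"
proof -
  have "shift_act (pCons a f) v i = (\<Sum>k\<le>Suc (degree f). coeff (pCons a f) k * v (i + k))"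
    by (intro shift_act_eq) (simp add: degree_pCons_le)
  also have "\<dots> = a * v i + shift_act f v (Suc i)"
    by (subst sum.atMost_Suc_shift) (simp add: shift_act_def)
  finally show ?thesis .
qed

lemma shift_act_1 [simp]: "shift_act 1 v i = v i"
  by (simp add: one_pCons)

lemma shift_act_add: "shift_act (f + g) v i = shift_act f v i + shift_act g v i"
proof (induction f g arbitrary: i rule: poly_induct2)
  case (pCons a p b q)
  then show ?case by (simp add: algebra_simps)
qed simp

lemma shift_act_smult: "shift_act (smult c f) v i = c * shift_act f v i"
  by (induction f arbitrary: i) (simp_all add: algebra_simps)

lemma shift_act_diff: "shift_act (f - g) v i = shift_act f v i - shift_act g v i"
  using shift_act_add[of "f - g" g v i] by simp

lemma shift_act_sum: "shift_act (sum f A) v i = (\<Sum>x\<in>A. shift_act (f x) v i)"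
  by (induction A rule: infinite_finite_induct) (simp_all add: shift_act_add)

lemma shift_act_monom: "shift_act (monom c k) v i = c * v (i + k)"
  by (induction k arbitrary: i) (simp_all add: monom_Suc monom_0)

lemma shift_act_mult: "shift_act (f * g) v i = shift_act f (shift_act g v) i"
proof (induction f arbitrary: i)
  case (pCons a f)
  then show ?case by (simp add: mult_pCons_left shift_act_add shift_act_smult)
qed simp

text \<open>The annihilator of a sequence is an ideal.\<close>

lemma shift_act_mult_zero:
  assumes "\<And>i. shift_act g v i = 0"
  shows "shift_act (f * g) v i = 0"
  using assms by (simp add: shift_act_mult shift_act_def[of f])

lemma antiperiodic_shift_act:
  assumes "\<And>i. v (i + n) = - v i"
  shows "shift_act f v (i + n) = - shift_act f v i"
proof -
  have "v (i + n + k) = - v (i + k)" for k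
    using assms[of "i + k"] by (simp add: add_ac)
  then show ?thesis by (simp add: shift_act_def sum_negf)
qed

section \<open>Descent along the prime factors of \<open>N\<close>\<close>

text \<open>On \<open>v\<close> the constant \<open>c\<close> acts as \<open>- p * w\<close>, so
  \<open>c ^ k * v j\<close> is divisible by \<open>p ^ k\<close> for every \<open>k\<close>. If
  \<open>p\<close> did not divide \<open>c\<close>, the nonzero integer \<open>v j\<close> would be
  divisible by all powers of \<open>p\<close>.\<close>

lemma shift_act_annihilated_dvd:
  fixes v :: "nat \<Rightarrow> int"
  assumes p: "prime p" and v: "v j \<noteq> 0"
    and ann: "\<And>i. shift_act ([:c:] + of_nat p * w) v i = 0"
  shows "int p dvd c"
proof (rule ccontr)
  assume "\<not> int p dvd c"
  then have cop: "coprime (int p) c"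
    using p by (simp add: prime_imp_coprime)
  have "int p ^ k dvd v j" for k
  proof -
    define u where "u = - (of_nat p * w)"
    have "[:c:] - u dvd [:c:] ^ k - u ^ k"
      by (simp add: power_diff_sumr2)
    then obtain h where "[:c:] ^ k - u ^ k = ([:c:] - u) * h"
      by (elim dvdE)
    then have "[:c:] ^ k - u ^ k = h * ([:c:] + of_nat p * w)"
      by (simp add: u_def mult.commute)
    then have "[:c:] ^ k = u ^ k + h * ([:c:] + of_nat p * w)"
      by (simp add: algebra_simps)
    also have "u ^ k = smult (int p ^ k) ((- w) ^ k)"
      by (simp add: u_def of_nat_poly smult_power flip: smult_minus_right)
    finally have "shift_act ([:c ^ k:]) v j = int p ^ k * shift_act ((- w) ^ k) v j"
      unfolding poly_const_pow
      by (simp only: shift_act_add[of _ "h * ([:c:] + of_nat p * w)"] shift_act_mult_zero[OF ann] shift_act_smult add_0_right)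
    then have "int p ^ k dvd c ^ k * v j" by simp
    then show ?thesis
      using cop by (simp add: coprime_dvd_mult_right_iff)
  qed
  \<comment> \<open>The exponent \<open>\<bar>v j\<bar>\<close> is already large enough to
    contradict divisibility.\<close>
  then have "int p ^ nat \<bar>v j\<bar> \<le> \<bar>v j\<bar>"
    using dvd_imp_le_int[OF v, of "int p ^ nat \<bar>v j\<bar>"] by simp
  moreover have "\<bar>v j\<bar> < int p ^ nat \<bar>v j\<bar>"
  proof -
    have "nat \<bar>v j\<bar> < p ^ nat \<bar>v j\<bar>"
      using prime_gt_1_nat[OF p] by (simp add: power_gt_expt)
    then have "int (nat \<bar>v j\<bar>) < int (p ^ nat \<bar>v j\<bar>)" by linarith
    then show ?thesis by simp
  qed
  ultimately show False by simp
qed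

text \<open>
  Since \<open>x \<mapsto> x ^ q\<close> for a suitable power \<open>q\<close> of \<open>p\<close> is the identity modulo \<open>p\<close> and
  \<open>X ^ m - 1\<close>, an element whose square is divisible by \<open>p\<close> is itself divisible by \<open>p\<close>.
\<close>
lemma shift_act_descent:
  fixes v :: "nat \<Rightarrow> int"
  assumes "m > 0" and v: "v j \<noteq> 0" and per: "\<And>i. v (i + m) = v i"
    and p: "prime p" and dvd: "p dvd N" and cop: "coprime p m"
    and ann: "\<And>i. shift_act (s ^ 2 + of_nat N) v i = 0"
  obtains N' w where "N = p ^ 2 * N'" "\<And>i. shift_act (w ^ 2 + of_nat N') v i = 0"
proof -
  obtain M where M: "N = p * M" using dvd by (elim dvdE)
  obtain q g h where q: "q \<ge> 2" and s: "s ^ q = s + of_nat p * g + (monom 1 m - 1) * h"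
    using power_cong_mod_cyclic[OF p cop \<open>m > 0\<close>] by blast
  \<comment> \<open>Chosen so that \<open>s\<close> acts on \<open>v\<close> as
    \<open>p * w\<close>: in the formula for \<open>s ^ q\<close>, the factor \<open>s ^ 2\<close>
    acts as \<open>- p * M\<close> and \<open>X ^ m - 1\<close> acts as 0.\<close>
  define w where "w = - (of_nat M * s ^ (q - 2) + g)"
  have cyc: "shift_act ((monom 1 m - 1) * f) v i = 0" for f i
  proof -
    have "shift_act (f * (monom 1 m - 1)) v i = 0"
      by (rule shift_act_mult_zero) (simp add: shift_act_diff shift_act_monom per)
    then show ?thesis by (simp only: mult.commute)
  qed
  have sq: "s ^ q = s ^ (q - 2) * s ^ 2"
    using q by (metis le_add_diff_inverse2 power_add)
  have "s - of_nat p * w = s ^ (q - 2) * (s ^ 2 + of_nat N) - (monom 1 m - 1) * h"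
    using s unfolding sq w_def M by (simp add: algebra_simps)
  then have 1: "shift_act (s - of_nat p * w) v i = 0" for i
    by (simp add: shift_act_diff shift_act_mult_zero[OF ann] cyc)
  \<comment> \<open>With \<open>s\<close> acting as \<open>p * w\<close>, the annihilator
    \<open>s ^ 2 + N\<close> becomes \<open>p * (M + p * w ^ 2)\<close>. Integer values allow
    cancelling \<open>p\<close>, after which \<open>p\<close> must divide \<open>M\<close>, and a
    second cancellation leaves \<open>w ^ 2 + N'\<close>.\<close>
  have "smult (int p) ([:int M:] + of_nat p * w ^ 2)
      = (s ^ 2 + of_nat N) - (s + of_nat p * w) * (s - of_nat p * w)"
    by (simp add: M of_nat_poly algebra_simps power2_eq_square smult_add_right)
  then have "shift_act (smult (int p) ([:int M:] + of_nat p * w ^ 2)) v i = 0" for i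
    by (simp only: shift_act_diff[of "s ^ 2 + of_nat N"] shift_act_mult_zero[OF 1] ann diff_0_right)
  then have 2: "shift_act ([:int M:] + of_nat p * w ^ 2) v i = 0" for i
    unfolding shift_act_smult using prime_gt_0_nat[OF p] by (metis mult_eq_0_iff not_less_zero of_nat_eq_0_iff)
  then have "int p dvd int M"
    using shift_act_annihilated_dvd[where v = v, OF p v] by blast
  then obtain N' where N': "M = p * N'" by auto
  have "[:int M:] + of_nat p * w ^ 2 = smult (int p) (w ^ 2 + of_nat N')"
    by (simp add: N' of_nat_poly algebra_simps smult_add_right)
  with 2 have "shift_act (w ^ 2 + of_nat N') v i = 0" for i
    using p by (simp add: shift_act_smult)
  then show ?thesis using that[of N' w] M N' by (simp add: power2_eq_square)
qed

text \<open>Each descent step removes a factor \<open>p ^ 2\<close> from \<open>N\<close> and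
  replaces \<open>s\<close> by another polynomial, until \<open>N = 1\<close> is reached; the
  removed squares multiply up to \<open>N\<close>.\<close>

lemma shift_act_square_neg:
  fixes v :: "nat \<Rightarrow> int"
  assumes "m > 0" and "v j \<noteq> 0" and "\<And>i. v (i + m) = v i"
    and "N > 0" and "coprime N m"
    and "\<And>i. shift_act (s ^ 2 + of_nat N) v i = 0"
  shows "\<exists>k. N = k ^ 2"
  using assms(4-)
proof (induction N arbitrary: s rule: less_induct)
  case (less N)
  show ?case
  proof (cases "N = 1")
    case True
    then show ?thesis by (metis one_power2)
  next
    case False
    then obtain p where p: "prime p" "p dvd N"
      using prime_factor_nat by blast
    have cop: "coprime p m"
      using less.prems(2) p(2) by (meson coprime_divisors dvd_refl)
    obtain N' w where N': "N = p ^ 2 * N'" and w: "\<And>i. shift_act (w ^ 2 + of_nat N') v i = 0"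
      using shift_act_descent[where v = v, OF assms(1-3) p cop less.prems(3)] by blast
    have "1 < p ^ 2" using prime_gt_1_nat[OF p(1)] by (intro one_less_power) auto
    then have "N' > 0" "N' < N" using N' less.prems(1) by auto
    moreover have "coprime N' m"
      using less.prems(2) N' by simp
    ultimately obtain k where "N' = k ^ 2"
      using less.IH w by blast
    then show ?thesis using N' by (metis power_mult_distrib)
  qed
qed

section \<open>Negacirculant matrices as polynomials in the shift\<close>

text \<open>Stated over any commutative ring, to serve both the real matrices of the theorem and
  their integer copies.\<close>

definition negacirculant_of :: "nat \<Rightarrow> 'a::comm_ring_1 vec \<Rightarrow> 'a mat" where
  "negacirculant_of n w = mat n n (\<lambda>(i, j). if i \<le> j then w $ (j - i) else - (w $ (n + j - i)))"

definition vec_poly :: "nat \<Rightarrow> 'a::comm_ring_1 vec \<Rightarrow> 'a poly" where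
  "vec_poly n w = (\<Sum>k<n. monom (w $ k) k)"

text \<open>On this extension the sign of the entries that wrap around in a negacirculant matrix is
  produced by the sequence itself.\<close>

definition antiperiodic_ext :: "nat \<Rightarrow> 'a::comm_ring_1 vec \<Rightarrow> nat \<Rightarrow> 'a" where
  "antiperiodic_ext n u i = (- 1) ^ (i div n) * u $ (i mod n)"

lemma negacirculant_of_carrier [simp]: "negacirculant_of n w \<in> carrier_mat n n"
  by (simp add: negacirculant_of_def)

lemma shift_act_vec_poly: "shift_act (vec_poly n w) v i = (\<Sum>k<n. w $ k * v (i + k))"
  by (simp add: vec_poly_def shift_act_sum shift_act_monom)

lemma antiperiodic_ext_less: "i < n \<Longrightarrow> antiperiodic_ext n u i = u $ i"
  by (simp add: antiperiodic_ext_def)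

lemma antiperiodic_ext_add: "n > 0 \<Longrightarrow> antiperiodic_ext n u (i + n) = - antiperiodic_ext n u i"
  by (simp add: antiperiodic_ext_def)

lemma antiperiodic_eq_ext:
  assumes "n > 0" and v: "\<And>i. v (i + n) = - v i" and "\<And>i. i < n \<Longrightarrow> u $ i = v i"
  shows "antiperiodic_ext n u = v"
proof
  fix i
  have "v (r + q * n) = (- 1) ^ q * v r" for q r
  proof (induction q)
    case (Suc q)
    have "v (r + Suc q * n) = v ((r + q * n) + n)" by (simp add: algebra_simps)
    then show ?case using Suc by (simp add: v)
  qed simp
  from this[of "i mod n" "i div n"] show "antiperiodic_ext n u i = v i"
    using assms(1,3) by (simp add: antiperiodic_ext_def)
qed

text \<open>Summation over the column \<open>j\<close> is reindexed by \<open>k\<close>, the residue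
  of \<open>j - i\<close> modulo \<open>n\<close>. For \<open>j < i\<close> the argument
  \<open>i + k\<close> is \<open>j + n\<close>, and antiperiodicity supplies the minus sign of that
  entry.\<close>

lemma negacirculant_of_mult_vec:
  assumes i: "i < n" and u: "u \<in> carrier_vec n"
  shows "(negacirculant_of n w *\<^sub>v u) $ i = shift_act (vec_poly n w) (antiperiodic_ext n u) i"
proof -
  have "(negacirculant_of n w *\<^sub>v u) $ i
      = (\<Sum>j<n. (if i \<le> j then w $ (j - i) else - (w $ (n + j - i))) * u $ j)"
    using i u by (simp add: negacirculant_of_def scalar_prod_def atLeast0LessThan)
  also have "\<dots> = (\<Sum>k<n. w $ k * antiperiodic_ext n u (i + k))"
  proof (rule sum.reindex_bij_witness[where
        i = "\<lambda>k. if i + k < n then i + k else i + k - n" and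
        j = "\<lambda>j. if i \<le> j then j - i else n + j - i"])
    fix j assume j: "j \<in> {..<n}"
    show "w $ (if i \<le> j then j - i else n + j - i)
        * antiperiodic_ext n u (i + (if i \<le> j then j - i else n + j - i))
      = (if i \<le> j then w $ (j - i) else - (w $ (n + j - i))) * u $ j"
    proof (cases "i \<le> j")
      case False
      then have "i + (n + j - i) = j + n" using i by simp
      then show ?thesis
        using False j i antiperiodic_ext_add[of n u j]
        by (simp add: antiperiodic_ext_less add.commute)
    qed (use j in \<open>simp add: antiperiodic_ext_less\<close>)
  qed (use i in auto)
  finally show ?thesis by (simp add: shift_act_vec_poly)
qed

lemma antiperiodic_ext_negacirculant_of_mult_vec:
  assumes "n > 0" and u: "u \<in> carrier_vec n"
  shows "antiperiodic_ext n (negacirculant_of n w *\<^sub>v u)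
    = shift_act (vec_poly n w) (antiperiodic_ext n u)"
  using assms
  by (intro antiperiodic_eq_ext antiperiodic_shift_act negacirculant_of_mult_vec antiperiodic_ext_add)

lemma negacirculant_of_mult_mult_vec:
  assumes "i < n" and u: "u \<in> carrier_vec n"
  shows "(negacirculant_of n a *\<^sub>v (negacirculant_of n b *\<^sub>v u)) $ i
    = shift_act (vec_poly n a * vec_poly n b) (antiperiodic_ext n u) i"
proof -
  have "negacirculant_of n b *\<^sub>v u \<in> carrier_vec n"
    using negacirculant_of_carrier u by (rule mult_mat_vec_carrier)
  with assms show ?thesis
    by (simp add: negacirculant_of_mult_vec antiperiodic_ext_negacirculant_of_mult_vec shift_act_mult)
qed

text \<open>Applied to unit vectors, either product acts as the product of the two polynomials,
  which commutes.\<close>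

lemma negacirculant_of_commute:
  "negacirculant_of n a * negacirculant_of n b = negacirculant_of n b * negacirculant_of n a"
proof (rule eq_matI)
  have entry: "(negacirculant_of n x * negacirculant_of n y) $$ (i, j)
      = shift_act (vec_poly n x * vec_poly n y) (antiperiodic_ext n (unit_vec n j)) i"
    if "i < n" "j < n" for x y :: "'a vec" and i j
  proof -
    have "col (negacirculant_of n y) j = negacirculant_of n y *\<^sub>v unit_vec n j"
      using that(2) by (intro eq_vecI) (auto simp: negacirculant_of_def)
    then show ?thesis
      using that by (simp flip: negacirculant_of_mult_mult_vec
          add: negacirculant_of_carrier[THEN carrier_matD(1)] negacirculant_of_carrier[THEN carrier_matD(2)])
  qed
  fix i j
  assume "i < dim_row (negacirculant_of n b * negacirculant_of n a)"
    "j < dim_col (negacirculant_of n b * negacirculant_of n a)"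
  then have "i < n" "j < n" by (simp_all add: negacirculant_of_def)
  then show "(negacirculant_of n a * negacirculant_of n b) $$ (i, j)
      = (negacirculant_of n b * negacirculant_of n a) $$ (i, j)"
    by (simp only: entry mult.commute)
qed (simp_all add: negacirculant_of_def)

lemma map_mat_add_of_int:
  "A \<in> carrier_mat n n \<Longrightarrow> B \<in> carrier_mat n n \<Longrightarrow>
    map_mat real_of_int (A + B) = map_mat of_int A + map_mat of_int B"
  by (rule eq_matI) auto

lemma smult_one_mat_mult_vec:
  "v \<in> carrier_vec n \<Longrightarrow> (c \<cdot>\<^sub>m 1\<^sub>m n) *\<^sub>v v = c \<cdot>\<^sub>v v" for v :: "'a::comm_ring_1 vec"
  by (intro eq_vecI) (auto simp: row_smult)

section \<open>Nonsingularity over the integers\<close>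

lemma det_negacirculant_of_nonzero:
  fixes n :: nat and a b :: "int vec"
  defines "A \<equiv> negacirculant_of n a" and "B \<equiv> negacirculant_of n b"
  assumes n: "n > 0" and nonsquare: "\<nexists>k. 2 * n - 1 = k ^ 2"
    and skew: "A + transpose_mat A = 2 \<cdot>\<^sub>m 1\<^sub>m n"
    and gram: "A * transpose_mat A + B * transpose_mat B = (2 * int n) \<cdot>\<^sub>m 1\<^sub>m n"
  shows "det B \<noteq> 0"
proof
  assume "det B = 0"
  have [simp]: "A \<in> carrier_mat n n" "B \<in> carrier_mat n n" by (simp_all add: A_def B_def)
  then have "det (transpose_mat B) = 0" using \<open>det B = 0\<close> by (simp add: det_transpose[of B n])
  \<comment> \<open>The kernel vector has integer entries, as the descent by divisibility
    requires.\<close>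
  then obtain v where v: "v \<in> carrier_vec n" "v \<noteq> 0\<^sub>v n" "transpose_mat B *\<^sub>v v = 0\<^sub>v n"
    using det_0_iff_vec_prod_zero[of "transpose_mat B" n] by auto
  define u where "u = antiperiodic_ext n v"
  define f where "f = vec_poly n a"
  have anti: "u (i + n) = - u i" for i by (simp add: u_def antiperiodic_ext_add n)
  have Av: "A *\<^sub>v v \<in> carrier_vec n" "transpose_mat A *\<^sub>v v \<in> carrier_vec n"
    using v(1) by (auto intro!: mult_mat_vec_carrier[of _ n n])
  have "A *\<^sub>v v + transpose_mat A *\<^sub>v v = (A + transpose_mat A) *\<^sub>v v"
    by (rule add_mult_distrib_mat_vec[symmetric, of _ n n]) (use v in auto)
  also have "\<dots> = 2 \<cdot>\<^sub>v v"
    unfolding skew using v(1) by (simp only: smult_one_mat_mult_vec)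
  finally have sum: "A *\<^sub>v v + transpose_mat A *\<^sub>v v = 2 \<cdot>\<^sub>v v" .
  have "(2 * int n) \<cdot>\<^sub>v v = ((2 * int n) \<cdot>\<^sub>m 1\<^sub>m n) *\<^sub>v v"
    using v(1) by (simp only: smult_one_mat_mult_vec)
  also have "\<dots> = (A * transpose_mat A) *\<^sub>v v + (B * transpose_mat B) *\<^sub>v v"
    unfolding gram[symmetric]
    by (rule add_mult_distrib_mat_vec[of _ n n]) (use v in \<open>auto intro!: mult_carrier_mat[of _ n n]\<close>)
  also have "(A * transpose_mat A) *\<^sub>v v = A *\<^sub>v (transpose_mat A *\<^sub>v v)"
    by (rule assoc_mult_mat_vec[of _ n n _ n]) (use v in auto)
  also have "(B * transpose_mat B) *\<^sub>v v = B *\<^sub>v (transpose_mat B *\<^sub>v v)"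
    by (rule assoc_mult_mat_vec[of _ n n _ n]) (use v in auto)
  also have "\<dots> = 0\<^sub>v n"
    unfolding v(3) by (intro eq_vecI) (auto simp: B_def negacirculant_of_def)
  finally have prod: "A *\<^sub>v (transpose_mat A *\<^sub>v v) = (2 * int n) \<cdot>\<^sub>v v"
    using Av by (metis \<open>A \<in> carrier_mat n n\<close> mult_mat_vec_carrier right_zero_vec)
  have "A *\<^sub>v (A *\<^sub>v v) + A *\<^sub>v (transpose_mat A *\<^sub>v v) = A *\<^sub>v (2 \<cdot>\<^sub>v v)"
    unfolding sum[symmetric] by (rule mult_add_distrib_mat_vec[symmetric, of _ n n]) (use Av in auto)
  also have "\<dots> = 2 \<cdot>\<^sub>v (A *\<^sub>v v)"
    using v(1) \<open>A \<in> carrier_mat n n\<close>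
    by (intro eq_vecI) (auto simp: scalar_prod_def sum_distrib_left algebra_simps)
  finally have key: "A *\<^sub>v (A *\<^sub>v v) + (2 * int n) \<cdot>\<^sub>v v = 2 \<cdot>\<^sub>v (A *\<^sub>v v)"
    unfolding prod .
  have small: "shift_act ((f - 1) ^ 2 + of_nat (2 * n - 1)) u i = 0" if "i < n" for i
  proof -
    have "shift_act (f * f) u i + 2 * int n * u i = 2 * shift_act f u i"
      using arg_cong[OF key, of "\<lambda>x. x $ i"] that v(1) Av
      by (simp add: A_def negacirculant_of_mult_mult_vec negacirculant_of_mult_vec f_def u_def
          antiperiodic_ext_less negacirculant_of_carrier[THEN carrier_matD(1)] del: index_mult_mat_vec)
    \<comment> \<open>Completing the square in \<open>f ^ 2 - 2 * f + 2 * n\<close>, which kills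
      \<open>u\<close> by \<open>key\<close>.\<close>
    moreover have "(f - 1) ^ 2 + of_nat (2 * n - 1) = f * f - smult 2 f + smult (2 * int n) 1"
      using n by (simp add: power2_eq_square algebra_simps of_nat_poly of_nat_diff one_pCons
          numeral_poly)
    ultimately show ?thesis
      by (simp add: shift_act_add shift_act_diff shift_act_smult)
  qed
  \<comment> \<open>The matrix identity covers only the indices below \<open>n\<close>;
    antiperiodicity carries it to all others.\<close>
  have ann: "shift_act ((f - 1) ^ 2 + of_nat (2 * n - 1)) u i = 0" for i
  proof (induction i rule: less_induct)
    case (less i)
    show ?case
    proof (cases "i < n")
      case False
      then obtain j where j: "i = j + n" by (metis add.commute le_Suc_ex not_less)
      then show ?thesis
        using less[of j] n antiperiodic_shift_act[of u n, OF anti] by simp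
    qed (rule small)
  qed
  \<comment> \<open>Two sign changes cancel, so the descent runs with \<open>m = 2 * n\<close>,
    which is coprime to its predecessor \<open>2 * n - 1\<close>.\<close>
  have per: "u (i + 2 * n) = u i" for i
    using anti[of i] anti[of "i + n"] by (simp add: add.assoc mult_2)
  obtain j where j: "j < n" "v $ j \<noteq> 0"
    using v(1,2) by (metis carrier_vecD eq_vecI index_zero_vec)
  then have "u j \<noteq> 0" by (simp add: u_def antiperiodic_ext_less)
  moreover have "coprime (2 * n - 1) (2 * n)"
    using n by (metis Suc_pred' coprime_Suc_right_nat mult_pos_pos zero_less_numeral diff_Suc_1 Suc_diff_1)
  ultimately have "\<exists>k. 2 * n - 1 = k ^ 2"
    using shift_act_square_neg[of "2 * n" u j "2 * n - 1" "f - 1"] n per ann by simp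
  with nonsquare show False by blast
qed

section \<open>Orders of Hadamard matrices and squares modulo 4\<close>

text \<open>For the first three rows, orthogonality leaves only the square of row 0 in the sum of
  \<open>(h0 + h1) * (h0 + h2)\<close>, which is \<open>m\<close>. Each summand is 4 where the three
  signs agree and 0 elsewhere.\<close>

lemma hadamard_order:
  fixes H :: "real mat"
  assumes H: "H \<in> carrier_mat m m" and entries: "\<forall>i<m. \<forall>j<m. H $$ (i, j) \<in> {1, -1}"
    and gram: "H * transpose_mat H = real m \<cdot>\<^sub>m 1\<^sub>m m" and m: "m \<ge> 3"
  shows "4 dvd m"
proof -
  have dot: "(\<Sum>j<m. H $$ (i, j) * H $$ (k, j)) = (if i = k then real m else 0)"
    if "i < m" "k < m" for i k
    using arg_cong[OF gram, of "\<lambda>M. M $$ (i, k)"] that H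
    by (simp add: scalar_prod_def atLeast0LessThan)
  have "real m = (\<Sum>j<m. (H $$ (0, j) + H $$ (1, j)) * (H $$ (0, j) + H $$ (2, j)))"
    using m by (simp add: algebra_simps sum.distrib dot)
  also have "\<dots> = (\<Sum>j<m. 4 * real (if H $$ (1, j) = H $$ (0, j) \<and> H $$ (2, j) = H $$ (0, j) then 1 else 0))"
  proof (rule sum.cong[OF refl])
    fix j assume "j \<in> {..<m}"
    then have "H $$ (0, j) \<in> {1, -1}" "H $$ (1, j) \<in> {1, -1}" "H $$ (2, j) \<in> {1, -1}"
      using entries m by auto
    then show "(H $$ (0, j) + H $$ (1, j)) * (H $$ (0, j) + H $$ (2, j))
      = 4 * real (if H $$ (1, j) = H $$ (0, j) \<and> H $$ (2, j) = H $$ (0, j) then 1 else 0)"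
      by auto
  qed
  also have "\<dots> = real (4 * (\<Sum>j<m. if H $$ (1, j) = H $$ (0, j) \<and> H $$ (2, j) = H $$ (0, j) then 1 else 0))"
    by (simp add: sum_distrib_left)
  finally have "m = 4 * (\<Sum>j<m. if H $$ (1, j) = H $$ (0, j) \<and> H $$ (2, j) = H $$ (0, j) then 1 else 0)"
    by (simp only: of_nat_eq_iff)
  then show ?thesis by (rule dvdI)
qed

lemma not_square_if_mod_4:
  assumes "n mod 4 = (3::nat)"
  shows "n \<noteq> k ^ 2"
proof
  assume "n = k ^ 2"
  have "k mod 4 = 0 \<or> k mod 4 = 1 \<or> k mod 4 = 2 \<or> k mod 4 = 3" by presburger
  then have "k ^ 2 mod 4 \<noteq> 3" by (auto simp: power_mod[symmetric, of k 2 4])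
  with assms \<open>n = k ^ 2\<close> show False by simp
qed

section \<open>Block matrices, inverses and passage to integer entries\<close>

lemma four_block_mat_cancel:
  assumes "four_block_mat A B C D = four_block_mat A' B' C' D'"
    and "A \<in> carrier_mat n1 m1" "B \<in> carrier_mat n1 m2" "D \<in> carrier_mat n2 m2"
    and "A' \<in> carrier_mat n1 m1" "B' \<in> carrier_mat n1 m2" "D' \<in> carrier_mat n2 m2"
  shows "A = A'" and "B = B'"
proof -
  have eq: "four_block_mat A B C D $$ (i, j) = four_block_mat A' B' C' D' $$ (i, j)" for i j
    using assms(1) by simp
  show "A = A'"
  proof (rule eq_matI)
    fix i j assume "i < dim_row A'" "j < dim_col A'"
    then show "A $$ (i, j) = A' $$ (i, j)" using eq[of i j] assms(2-) by auto
  qed (use assms in auto)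
  show "B = B'"
  proof (rule eq_matI)
    fix i j assume "i < dim_row B'" "j < dim_col B'"
    then show "B $$ (i, j) = B' $$ (i, j)" using eq[of i "m1 + j"] assms(2-) by auto
  qed (use assms in auto)
qed

lemma invertible_mat_if_det_nonzero:
  fixes A :: "'a::field mat"
  assumes A: "A \<in> carrier_mat n n" and "det A \<noteq> 0"
  shows "invertible_mat A"
proof -
  from det_non_zero_imp_unit[OF assms] obtain B where
    "B \<in> carrier_mat n n" "B * A = 1\<^sub>m n" "A * B = 1\<^sub>m n"
    by (auto simp: Units_def ring_mat_def)
  with A show ?thesis
    unfolding invertible_mat_def inverts_mat_def by auto
qed

lemma negacirculant_iff: "negacirculant n A \<longleftrightarrow> (\<exists>w \<in> carrier_vec n. A = negacirculant_of n w)"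
  by (simp add: negacirculant_def negacirculant_of_def)

text \<open>Row 0 is the defining vector itself, so integrality there spreads to the whole matrix,
  and taking floors changes no entry.\<close>

lemma negacirculant_integral:
  assumes "negacirculant n A" and ints: "\<And>k. k < n \<Longrightarrow> A $$ (0, k) \<in> \<int>"
  obtains a where "A = map_mat of_int (negacirculant_of n a)"
proof -
  obtain w where w: "A = negacirculant_of n w" using assms(1) by (auto simp: negacirculant_iff)
  have "w $ k \<in> \<int>" if "k < n" for k
    using ints[OF that] that by (simp add: w negacirculant_of_def)
  then have "A = map_mat of_int (negacirculant_of n (vec n (\<lambda>k. \<lfloor>w $ k\<rfloor>)))"
    unfolding w by (intro eq_matI) (auto simp: negacirculant_of_def)
  then show ?thesis by (rule that)
qed

theorem theorem4p23:
  fixes n :: nat and H P Q R :: "real mat"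
  assumes "negacirculant n P" and "negacirculant n Q" and "negacirculant n R"
    and "H = four_block_mat P Q (- transpose_mat Q) (transpose_mat R)"
    and "skew_hadamard (2 * n) H"
  shows "invertible_mat Q \<and> R = P"
proof -
  obtain p q r where pqr: "P = negacirculant_of n p" "Q = negacirculant_of n q" "R = negacirculant_of n r"
    using assms(1-3) by (auto simp: negacirculant_iff)
  then have C [simp]: "P \<in> carrier_mat n n" "Q \<in> carrier_mat n n" "R \<in> carrier_mat n n" by simp_all
  then have D [simp]: "dim_row P = n" "dim_col P = n" "dim_row Q = n" "dim_col Q = n"
    "dim_row R = n" "dim_col R = n" by blast+
  have carrier: "H \<in> carrier_mat (2 * n) (2 * n)"
    and entries: "\<forall>i<2*n. \<forall>j<2*n. H $$ (i, j) \<in> {1, -1}"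
    and gram: "H * transpose_mat H = real (2 * n) \<cdot>\<^sub>m 1\<^sub>m (2 * n)"
    and skew: "H + transpose_mat H = 2 \<cdot>\<^sub>m 1\<^sub>m (2 * n)"
    using assms(5) unfolding skew_hadamard_def by blast+
  have HT: "transpose_mat H = four_block_mat (transpose_mat P) (- Q) (transpose_mat Q) R"
    unfolding assms(4) by (subst transpose_four_block_mat[of _ n n _ n _ n]) (auto simp: transpose_uminus)
  have scalar: "c \<cdot>\<^sub>m 1\<^sub>m (2 * n)
      = four_block_mat (c \<cdot>\<^sub>m 1\<^sub>m n) (0\<^sub>m n n) (0\<^sub>m n n) (c \<cdot>\<^sub>m 1\<^sub>m n)" for c :: real
    by (rule eq_matI) auto
  \<comment> \<open>The upper left block of the Gram identity gives \<open>gramP\<close>, the upper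
    right one gives \<open>PQ\<close>.\<close>
  have "four_block_mat (P * transpose_mat P + Q * transpose_mat Q) (P * (- Q) + Q * R)
      (- transpose_mat Q * transpose_mat P + transpose_mat R * transpose_mat Q)
      (- transpose_mat Q * (- Q) + transpose_mat R * R)
    = four_block_mat (real (2 * n) \<cdot>\<^sub>m 1\<^sub>m n) (0\<^sub>m n n) (0\<^sub>m n n) (real (2 * n) \<cdot>\<^sub>m 1\<^sub>m n)"
    unfolding scalar[symmetric] gram[symmetric] HT unfolding assms(4)
    by (rule mult_four_block_mat[symmetric, of _ n n _ n _ n _ _ n _ n]) auto
  note blocks = four_block_mat_cancel[OF this, of n n n n]
  have gramP: "P * transpose_mat P + Q * transpose_mat Q = real (2 * n) \<cdot>\<^sub>m 1\<^sub>m n"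
    by (rule blocks(1)) auto
  have "P * (- Q) + Q * R = 0\<^sub>m n n"
    by (rule blocks(2)) auto
  then have zero: "(P * (- Q) + Q * R) $$ (i, j) = 0" if "i < n" "j < n" for i j
    using that by simp
  have PQ: "Q * R = P * Q"
  proof (rule eq_matI)
    fix i j assume "i < dim_row (P * Q)" "j < dim_col (P * Q)"
    then show "(Q * R) $$ (i, j) = (P * Q) $$ (i, j)"
      using zero[of i j] by (simp add: col_uminus)
  qed simp_all
  have "four_block_mat (P + transpose_mat P) (Q + - Q) (- transpose_mat Q + transpose_mat Q) (transpose_mat R + R)
    = four_block_mat (2 \<cdot>\<^sub>m 1\<^sub>m n) (0\<^sub>m n n) (0\<^sub>m n n) (2 \<cdot>\<^sub>m 1\<^sub>m n)"
    unfolding scalar[symmetric] skew[symmetric] HT unfolding assms(4)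
    by (rule add_four_block_mat[symmetric, of _ n n _ n _ n]) auto
  then have skewP: "P + transpose_mat P = 2 \<cdot>\<^sub>m 1\<^sub>m n"
    by (rule four_block_mat_cancel(1)[of _ _ _ _ _ _ _ _ n n n n]) auto
  have entP: "P $$ (0, k) \<in> {1, -1}" and entQ: "Q $$ (0, k) \<in> {1, -1}" if "k < n" for k
    using entries[rule_format, of 0 k] entries[rule_format, of 0 "n + k"] that
    by (auto simp: assms(4))
  have det: "det Q \<noteq> 0"
  proof -
    \<comment> \<open>Three rows, hence \<open>n \<ge> 2\<close>, are required for the order to be
      divisible by 4. For \<open>n = 0\<close> the empty determinant is 1, and for
      \<open>n = 1\<close> it is the single entry of \<open>Q\<close>, a sign.\<close>
    consider "n = 0" | "n = 1" | "n \<ge> 2" by linarith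
    then show ?thesis
    proof cases
      case 1
      then show ?thesis using C(2) by (simp add: det_dim_zero)
    next
      case 2
      then show ?thesis using C(2) entQ[of 0] by (auto simp: det_single)
    next
      case 3
      have "4 dvd 2 * n"
        using hadamard_order[OF carrier entries gram] 3 by simp
      then obtain c where c: "2 * n = 4 * c" by (elim dvdE)
      then have "2 * n - 1 = 3 + 4 * (c - 1)" using 3 by simp
      then have "(2 * n - 1) mod 4 = 3" by simp
      then have nonsquare: "\<nexists>k. 2 * n - 1 = k ^ 2" by (simp add: not_square_if_mod_4)
      have Ints: "x \<in> \<int>" if "x \<in> {1, -1}" for x :: real using that by auto
      obtain a where a: "P = map_mat of_int (negacirculant_of n a)"
        using negacirculant_integral[OF assms(1) Ints[OF entP]] .
      obtain b where b: "Q = map_mat of_int (negacirculant_of n b)"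
        using negacirculant_integral[OF assms(2) Ints[OF entQ]] .
      let ?A = "negacirculant_of n a" and ?B = "negacirculant_of n b"
      \<comment> \<open>Both identities descend to the integer copies because the embedding of
        integer matrices is injective.\<close>
      have "map_mat real_of_int (?A + transpose_mat ?A) = map_mat real_of_int (2 \<cdot>\<^sub>m 1\<^sub>m n)"
      proof -
        have "map_mat real_of_int (?A + transpose_mat ?A) = P + transpose_mat P"
          unfolding a by (rule eq_matI) (auto simp: negacirculant_of_def)
        then show ?thesis unfolding skewP by (auto intro!: eq_matI)
      qed
      then have 1: "?A + transpose_mat ?A = 2 \<cdot>\<^sub>m 1\<^sub>m n"
        by (rule of_int_hom.mat_hom_inj)
      have "map_mat real_of_int (?A * transpose_mat ?A + ?B * transpose_mat ?B)
          = map_mat real_of_int ((2 * int n) \<cdot>\<^sub>m 1\<^sub>m n)"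
      proof -
        have "map_mat real_of_int (X * transpose_mat X) = map_mat of_int X * transpose_mat (map_mat of_int X)"
          if "X \<in> carrier_mat n n" for X
          using that by (subst of_int_hom.mat_hom_mult[of _ n n _ n]) (auto simp: map_mat_transpose)
        then have "map_mat real_of_int (?A * transpose_mat ?A + ?B * transpose_mat ?B)
            = P * transpose_mat P + Q * transpose_mat Q"
          unfolding a b
          by (subst map_mat_add_of_int[of _ n]) (auto intro!: mult_carrier_mat[of _ n n])
        then show ?thesis unfolding gramP by (auto intro!: eq_matI)
      qed
      then have 2: "?A * transpose_mat ?A + ?B * transpose_mat ?B = (2 * int n) \<cdot>\<^sub>m 1\<^sub>m n"
        by (rule of_int_hom.mat_hom_inj)
      have "det ?B \<noteq> 0"
        using det_negacirculant_of_nonzero[OF _ nonsquare 1 2] 3 by simp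
      then show ?thesis unfolding b by simp
    qed
  qed
  have inv: "invertible_mat Q"
    using invertible_mat_if_det_nonzero[OF C(2) det] .
  obtain B where B: "B \<in> carrier_mat n n" "B * Q = 1\<^sub>m n"
    using det_non_zero_imp_unit[OF C(2) det] by (auto simp: Units_def ring_mat_def)
  \<comment> \<open>Together with \<open>PQ\<close> this gives \<open>Q * R = Q * P\<close>, from
    which the left inverse \<open>B\<close> removes \<open>Q\<close>.\<close>
  have "Q * P = P * Q" unfolding pqr by (rule negacirculant_of_commute)
  with PQ have "Q * R = Q * P" by simp
  then have "(B * Q) * R = (B * Q) * P"
    using B(1) by (simp only: assoc_mult_mat[of B n n Q n R n] assoc_mult_mat[of B n n Q n P n] C)
  then have "R = P" unfolding B(2) by simp
  with inv show ?thesis by blast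
qed

end
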